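(* Let $n \ge d \ge 2$. Let $X(t)\in\mathbb{R}^{n\times d}$ be a differentiable curve satisfying $\dot X = NX$ with $N = N^\top \in \mathbb{R}^{n\times n}$. Let $S(t)\in O(d)$ be a differentiable curve of orthogonal matrices and define $\tilde X(t) = X(t)S(t)$. Then $$\dot{\tilde X} = N\tilde X + \tilde X\,\Omega,$$ where $\Omega(t) = S(t)^\top \dot S(t)\in\mathfrak{so}(d)$ is skew-symmetric. Moreover, if $\tilde X(t)$ has full column rank for all $t$ in an interval, then the following are equivalent on that interval: (1) there exists a matrix function $\tilde N(t)\in\mathbb{R}^{n\times n}$ with $\tilde N(t) = \tilde N(t)^\top$ such that $\dot{\tilde X}(t) = \tilde N(t)\tilde X(t)$; (2) $\Omega(t) = 0$ (i.e. $S(t)$ is constant in time).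
   Context: $O(d)$ is the orthogonal group and $\mathfrak{so}(d)$ the space of real skew-symmetric $d\times d$ matrices. *)

theory Defs
  imports "HOL-Analysis.Analysis"
begin

definition symmetric_matrix :: "real^'n^'n \<Rightarrow> bool" where
  "symmetric_matrix A \<longleftrightarrow> transpose A = A"

definition skew_symmetric_matrix :: "real^'n^'n \<Rightarrow> bool" where
  "skew_symmetric_matrix A \<longleftrightarrow> transpose A = - A"

text \<open>
  Time intervals may be open, closed, half-open or unbounded, but contain at least two points:
  at the only point of a one-point set every vector is a derivative within that set.
\<close>
definition time_interval :: "real set \<Rightarrow> bool" where
  "time_interval J \<longleftrightarrow> is_interval J \<and> (\<exists>a\<in>J. \<exists>b\<in>J. a < b)"

text \<open>
  The derivative is taken within the domain \<open>J\<close> of the curve, hence it is one-sided at an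
  endpoint of \<open>J\<close> that belongs to \<open>J\<close> and the usual derivative in the interior.
\<close>
definition angular_velocity :: "real set \<Rightarrow> (real \<Rightarrow> real^'d^'d) \<Rightarrow> real \<Rightarrow> real^'d^'d" where
  "angular_velocity J S t = transpose (S t) ** vector_derivative S (at t within J)"

end

theory Submission
  imports Defs
begin

text \<open>
  The product rule gives the equation for \<open>Xtilde\<close>, and differentiating \<open>S\<^sup>T S = 1\<close> shows that
  \<open>\<Omega>\<close> is skew. If also \<open>Xtilde' = Ntilde Xtilde\<close>, then \<open>(Ntilde - N) Xtilde = Xtilde \<Omega>\<close> with
  \<open>Ntilde - N\<close> symmetric, so \<open>G \<Omega>\<close> is symmetric for the Gram matrix \<open>G = Xtilde\<^sup>T Xtilde\<close>, that is,
  \<open>G \<Omega> = - \<Omega> G\<close>. Cyclicity of the trace turns this into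
  \<open>tr (\<Omega>\<^sup>T G \<Omega>) = - tr (\<Omega>\<^sup>T G \<Omega>)\<close>, so the Frobenius norm of \<open>Xtilde \<Omega>\<close> is zero, and full column
  rank yields \<open>\<Omega> = 0\<close>.
\<close>

text \<open>Common source of the product rule for matrix curves and of the sign and difference rules
  below.\<close>

lemma bounded_bilinear_matrix_matrix_mult:
  "bounded_bilinear ((**) :: real^'m^'n \<Rightarrow> real^'p^'m \<Rightarrow> real^'p^'n)"
  unfolding bilinear_conv_bounded_bilinear [symmetric] bilinear_def
  by (intro allI conjI linearI)
    (simp_all add: matrix_matrix_mult_def vec_eq_iff algebra_simps sum.distrib sum_distrib_left)

lemmas matrix_mult_minus_left = bounded_bilinear.minus_left [OF bounded_bilinear_matrix_matrix_mult]
lemmas matrix_mult_minus_right = bounded_bilinear.minus_right [OF bounded_bilinear_matrix_matrix_mult]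
lemmas matrix_mult_diff_left = bounded_bilinear.diff_left [OF bounded_bilinear_matrix_matrix_mult]

lemma has_vector_derivative_matrix_mult:
  fixes F :: "real \<Rightarrow> real^'m^'n" and G :: "real \<Rightarrow> real^'p^'m"
  assumes "(F has_vector_derivative F') (at t within J)"
    and "(G has_vector_derivative G') (at t within J)"
  shows "((\<lambda>t. F t ** G t) has_vector_derivative F t ** G' + F' ** G t) (at t within J)"
  using bounded_bilinear.has_vector_derivative [OF bounded_bilinear_matrix_matrix_mult assms] .

lemma bounded_linear_transpose: "bounded_linear (transpose :: real^'m^'n \<Rightarrow> real^'n^'m)"
  unfolding linear_conv_bounded_linear [symmetric]
  by (intro linearI) (simp_all add: transpose_def vec_eq_iff)

text \<open>The inner product on matrices is entrywise, so both sides are the same double sum of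
  squared entries, with rows and columns summed in opposite order.\<close>

lemma trace_transpose_mult_self:
  fixes A :: "real^'m^'n"
  shows "trace (transpose A ** A) = A \<bullet> A"
  unfolding trace_def matrix_matrix_mult_def transpose_def inner_vec_def
  by (simp, rule sum.swap)

text \<open>Full column rank means injectivity, hence a left inverse, which cancels
  \<open>A\<close>.\<close>

lemma full_rank_mult_eq_0:
  fixes A :: "real^'m^'n" and B :: "real^'p^'m"
  assumes "rank A = CARD('m)" and "A ** B = 0"
  shows "B = 0"
proof -
  obtain C where "C ** A = mat 1"
    using assms(1) unfolding full_rank_injective matrix_left_invertible_injective [symmetric] by blast
  then show ?thesis
    using assms(2) by (metis matrix_mul_assoc matrix_mul_lid times0_right)
qed

lemma skew_eq_0_if_symmetric_intertwining:
  fixes Y :: "real^'d^'n" and M :: "real^'n^'n" and W :: "real^'d^'d"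
  assumes "symmetric_matrix M" and "skew_symmetric_matrix W"
    and "M ** Y = Y ** W" and "rank Y = CARD('d)"
  shows "W = 0"
proof -
  define G where "G = transpose Y ** Y"
  have M: "transpose M = M" and W: "transpose W = - W"
    using assms(1,2) by (simp_all add: symmetric_matrix_def skew_symmetric_matrix_def)
  have GT: "transpose G = G"
    by (simp add: G_def matrix_transpose_mul)
  \<comment> \<open>The intertwining relation makes \<open>G ** W\<close> a congruence transform of
    \<open>M\<close>, hence symmetric. Transposing it factor by factor gives
    \<open>- (W ** G)\<close> instead.\<close>
  have GW: "G ** W = transpose Y ** M ** Y"
    by (simp add: G_def assms(3) flip: matrix_mul_assoc)
  then have "transpose (G ** W) = G ** W"
    by (simp add: matrix_transpose_mul M matrix_mul_assoc)
  then have anti: "G ** W = - (W ** G)"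
    by (simp add: matrix_transpose_mul GT W matrix_mult_minus_left)
  have "trace (W ** (G ** W)) = - trace (W ** (W ** G))"
    by (simp add: anti matrix_mult_minus_right trace_def sum_negf)
  also have "trace (W ** (W ** G)) = trace (W ** (G ** W))"
    by (metis matrix_mul_assoc trace_mul_sym)
  finally have "trace (W ** (G ** W)) = 0"
    by simp
  \<comment> \<open>The sign comes from skewness of \<open>W\<close>; taking traces, the squared
    Frobenius norm of \<open>Y ** W\<close> vanishes.\<close>
  moreover have "transpose (Y ** W) ** (Y ** W) = - (W ** (G ** W))"
    by (simp add: G_def matrix_transpose_mul W matrix_mult_minus_left matrix_mul_assoc)
  ultimately have "Y ** W = 0"
    using trace_transpose_mult_self [of "Y ** W"] by (simp add: trace_def sum_negf)
  then show ?thesis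
    using full_rank_mult_eq_0 assms(4) by blast
qed

text \<open>A connected set with more than one point has no isolated points. This makes derivatives
  within \<open>J\<close> unique, endpoints included.\<close>

lemma time_interval_at_within_neq_bot:
  assumes "time_interval J" and "t \<in> J"
  shows "at t within J \<noteq> bot"
proof -
  obtain a b where "a \<in> J" "b \<in> J" "a < b"
    using assms(1) by (auto simp: time_interval_def)
  then have "\<not> (\<exists>x. J = {x})"
    by auto
  moreover have "connected J"
    using assms(1) by (simp add: time_interval_def is_interval_connected)
  ultimately show ?thesis
    using assms(2) connected_imp_perfect trivial_limit_within by blast
qed

lemma skew_symmetric_orthogonal_derivative:
  fixes S :: "real \<Rightarrow> real^'d^'d"
  assumes "at t within J \<noteq> bot" and "t \<in> J" and orth: "\<forall>s\<in>J. orthogonal_matrix (S s)"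
    and D: "(S has_vector_derivative S') (at t within J)"
  shows "skew_symmetric_matrix (transpose (S t) ** S')"
proof -
  let ?P = "transpose (S t) ** S' + transpose S' ** S t"
  have "((\<lambda>s. transpose (S s)) has_vector_derivative transpose S') (at t within J)"
    using bounded_linear.has_vector_derivative [OF bounded_linear_transpose D] .
  then have "((\<lambda>s. transpose (S s) ** S s) has_vector_derivative ?P) (at t within J)"
    by (rule has_vector_derivative_matrix_mult [OF _ D])
  \<comment> \<open>Orthogonality makes the product constant on \<open>J\<close>, and a derivative
    within \<open>J\<close> sees only values there. Uniqueness then forces \<open>?P = 0\<close>,
    which is skewness written as a sum.\<close>
  then have "((\<lambda>s. mat 1) has_vector_derivative ?P) (at t within J)"
    by (rule has_vector_derivative_transform [OF \<open>t \<in> J\<close>, rotated])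
      (use orth in \<open>simp add: orthogonal_matrix\<close>)
  then have "?P = 0"
    using vector_derivative_unique_within [OF assms(1) _ has_vector_derivative_const] by blast
  then show ?thesis
    by (simp add: skew_symmetric_matrix_def matrix_transpose_mul eq_neg_iff_add_eq_0 add.commute)
qed

theorem theorem4:
  fixes X Xtilde :: "real \<Rightarrow> real^'d^'n"
    and N :: "real \<Rightarrow> real^'n^'n"
    and S \<Omega> :: "real \<Rightarrow> real^'d^'d"
    and J :: "real set"
  assumes "2 \<le> CARD('d)" and "CARD('d) \<le> CARD('n)"
    and "time_interval J"
    and "\<forall>t\<in>J. symmetric_matrix (N t)"
    and "\<forall>t\<in>J. (X has_vector_derivative N t ** X t) (at t within J)"
    and "\<forall>t\<in>J. orthogonal_matrix (S t)"
    and "S differentiable_on J"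
    and "Xtilde = (\<lambda>t. X t ** S t)"
    and "\<Omega> = angular_velocity J S"
  shows "(\<forall>t\<in>J. (Xtilde has_vector_derivative N t ** Xtilde t + Xtilde t ** \<Omega> t) (at t within J)
            \<and> skew_symmetric_matrix (\<Omega> t))
    \<and> (\<forall>I. time_interval I \<and> I \<subseteq> J \<and> (\<forall>t\<in>I. rank (Xtilde t) = CARD('d)) \<longrightarrow>
          ((\<exists>Ntilde :: real \<Rightarrow> real^'n^'n. \<forall>t\<in>I. symmetric_matrix (Ntilde t)
              \<and> (Xtilde has_vector_derivative Ntilde t ** Xtilde t) (at t within J))
            \<longleftrightarrow> (\<forall>t\<in>I. \<Omega> t = 0))
          \<and> ((\<forall>t\<in>I. \<Omega> t = 0) \<longleftrightarrow> S constant_on I))"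
proof -
  define S' where "S' t = vector_derivative S (at t within J)" for t
  have \<Omega>: "\<Omega> t = transpose (S t) ** S' t" for t
    by (simp add: assms(9) angular_velocity_def S'_def)
  have dS: "(S has_vector_derivative S' t) (at t within J)" if "t \<in> J" for t
    using assms(7) that by (simp add: S'_def differentiable_on_def vector_derivative_works)
  \<comment> \<open>Turns the term \<open>X t ** S' t\<close> of the product rule into
    \<open>Xtilde t ** \<Omega> t\<close>.\<close>
  have S\<Omega>: "S t ** \<Omega> t = S' t" if "t \<in> J" for t
  proof -
    have "S t ** transpose (S t) = mat 1"
      using assms(6) that by (simp add: orthogonal_matrix_def)
    then show ?thesis
      by (simp add: \<Omega> matrix_mul_assoc)
  qed
  have dX: "(Xtilde has_vector_derivative N t ** Xtilde t + Xtilde t ** \<Omega> t) (at t within J)"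
    if "t \<in> J" for t
  proof -
    have "(X has_vector_derivative N t ** X t) (at t within J)"
      using assms(5) that by blast
    from has_vector_derivative_matrix_mult [OF this dS [OF that]] show ?thesis
      unfolding assms(8) by (simp add: S\<Omega> [OF that] add.commute flip: matrix_mul_assoc)
  qed
  have skew: "skew_symmetric_matrix (\<Omega> t)" if "t \<in> J" for t
    unfolding \<Omega> using skew_symmetric_orthogonal_derivative
      [OF time_interval_at_within_neq_bot [OF assms(3) that] that assms(6) dS [OF that]] .
  have "((\<exists>Ntilde. \<forall>t\<in>I. symmetric_matrix (Ntilde t)
           \<and> (Xtilde has_vector_derivative Ntilde t ** Xtilde t) (at t within J))
          \<longleftrightarrow> (\<forall>t\<in>I. \<Omega> t = 0))
        \<and> ((\<forall>t\<in>I. \<Omega> t = 0) \<longleftrightarrow> S constant_on I)"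
    if I: "time_interval I" "I \<subseteq> J" and full: "\<forall>t\<in>I. rank (Xtilde t) = CARD('d)" for I
  proof (intro conjI iffI ballI)
    fix t
    assume "\<exists>Ntilde. \<forall>t\<in>I. symmetric_matrix (Ntilde t)
           \<and> (Xtilde has_vector_derivative Ntilde t ** Xtilde t) (at t within J)"
      and t: "t \<in> I"
    then obtain N' where N': "symmetric_matrix N'"
      and dN': "(Xtilde has_vector_derivative N' ** Xtilde t) (at t within J)"
      by blast
    have tJ: "t \<in> J"
      using t I(2) by blast
    have "N' ** Xtilde t = N t ** Xtilde t + Xtilde t ** \<Omega> t"
      using vector_derivative_unique_within
        [OF time_interval_at_within_neq_bot [OF assms(3) tJ] dN' dX [OF tJ]] .
    then have "(N' - N t) ** Xtilde t = Xtilde t ** \<Omega> t"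
      by (simp add: matrix_mult_diff_left)
    moreover have "symmetric_matrix (N' - N t)"
      using N' assms(4) tJ by (simp add: symmetric_matrix_def transpose_def vec_eq_iff)
    ultimately show "\<Omega> t = 0"
      using skew_eq_0_if_symmetric_intertwining skew [OF tJ] full t by blast
  next
    assume "\<forall>t\<in>I. \<Omega> t = 0"
    \<comment> \<open>With \<Omega> zero the extra term drops out, so \<open>N\<close> itself is the
      witness.\<close>
    then have "\<forall>t\<in>I. symmetric_matrix (N t)
           \<and> (Xtilde has_vector_derivative N t ** Xtilde t) (at t within J)"
      using dX assms(4) I(2) by fastforce
    then show "\<exists>Ntilde. \<forall>t\<in>I. symmetric_matrix (Ntilde t)
           \<and> (Xtilde has_vector_derivative Ntilde t ** Xtilde t) (at t within J)"
      by blast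
  next
    assume 0: "\<forall>t\<in>I. \<Omega> t = 0"
    \<comment> \<open>\<Omega> is known to vanish only on \<open>I\<close>, so the derivative is
      restricted from \<open>J\<close> to \<open>I\<close>, whose convexity then gives
      constancy.\<close>
    have "(S has_vector_derivative 0) (at t within I)" if "t \<in> I" for t
    proof -
      have "t \<in> J"
        using that I(2) by blast
      moreover from this have "S' t = 0"
        using S\<Omega> 0 that by (metis times0_right)
      ultimately show ?thesis
        using dS has_vector_derivative_within_subset I(2) by metis
    qed
    moreover have "convex I"
      using I(1) by (simp add: time_interval_def is_interval_convex)
    ultimately obtain c where "\<And>t. t \<in> I \<Longrightarrow> S t = c"
      using has_vector_derivative_zero_constant by blast
    then show "S constant_on I"
      by (auto simp: constant_on_def)
  next
    fix t
    assume "S constant_on I" and t: "t \<in> I"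
    then obtain c where c: "\<And>s. s \<in> I \<Longrightarrow> S s = c"
      by (auto simp: constant_on_def)
    have tJ: "t \<in> J"
      using t I(2) by blast
    \<comment> \<open>\<open>S\<close> is constant only on \<open>I\<close>, so the two derivatives
      are compared within \<open>I\<close>; this works even at an endpoint of \<open>I\<close>
      inside \<open>J\<close>.\<close>
    have "(S has_vector_derivative 0) (at t within I)"
      using has_vector_derivative_transform [OF t c has_vector_derivative_const] .
    moreover have "(S has_vector_derivative S' t) (at t within I)"
      using has_vector_derivative_within_subset [OF dS [OF tJ] I(2)] .
    ultimately have "S' t = 0"
      using vector_derivative_unique_within [OF time_interval_at_within_neq_bot [OF I(1) t]] by blast
    then show "\<Omega> t = 0"
      by (simp add: \<Omega>)
  qed
  with dX skew show ?thesis
    by blast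
qed

end
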